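(* Let $X_{\mathcal{T}}$ be a tiling space of $\mathbb{R}^d$ with $\mathcal{T}$ finite, and let $x \in X_{\mathcal{T}}$ be an arbitrary tiling. Given $\epsilon > 0$ and a finite subset $F \subset \mathbb{R}^d$, there exist an $n \in \mathbb{N}$, a point $\vec{v} \in \mathbb{R}^d$, and a patch $p = \{t_i\}_{i=1}^m$ contained in $x$ such that (1) $B_{\frac{1}{\epsilon}}(\vec{v}) \subset \operatorname{supp}(p)$; (2) for each $\vec{u} \in F$ and each $1 \leq i \leq m$ there exists $S_i \in B_\epsilon(\mathcal{E}^d)$ such that $T_{n\vec{u} + \vec{v}}\, S_i\, T_{-\vec{v}}\, t_i \in x$.
   Context: A set $D \subset \mathbb{R}^d$ is a tile if it is compact and equal to the closure of its interior. A tiling of $\mathbb{R}^d$ is a collection of tiles $\{D_i\}$ with $\bigcup_i D_i = \mathbb{R}^d$ and $D_i^\circ \cap D_j^\circ = \varnothing$ for all $i \neq j$. Two tiles are equivalent if one is a translation of the other; an equivalence class is called a prototile. Two tiles are congruent if they are related by an orientation preserving isometry of $\mathbb{R}^d$; an equivalence class of congruent tiles is called a congruence prototile. For a finite set $\mathcal{T}$ of distinct prototiles (respectively congruence prototiles), the tiling space $X_{\mathcal{T}}$ is the set of all tilings of $\mathbb{R}^d$ by tiles that are elements of the prototiles (respectively congruence prototiles) in $\mathcal{T}$. No finiteness assumption is made on the set of pairs of adjacent tiles. A ($\mathcal{T}$-)patch is a subset (subcollection of tiles) $x'$ of a tiling $x \in X_{\mathcal{T}}$ such that the union of the tiles in $x'$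 is a connected subset of $\mathbb{R}^d$; this union is called the support of $x'$ and denoted $\operatorname{supp}(x')$. Writing $p = \{t_i\}_{i=1}^m$ means that the patch $p$ consists of the finitely many tiles $t_1, \dots, t_m$. $\mathcal{E}^d$ is the group of direct isometries $\vec{p} \mapsto A\vec{p} + \vec{b}$ of $\mathbb{R}^d$, with $A \in SO(d)$, $\vec{b} \in \mathbb{R}^d$. For $r>0$, $B_r(\mathcal{E}^d)$ is the set of those isometries $\vec{p} \mapsto A\vec{p}+\vec{b}$ in $\mathcal{E}^d$ with $\|A - \mathrm{Id}\| < r$ and $\|\vec{b}\| < r$, where $\|\cdot\|$ is the Euclidean norm for vectors and the operator norm for matrices. $B_r(\vec{v}) = \{\vec{q} \in \mathbb{R}^d : \|\vec{q} - \vec{v}\| \le r\}$. For $\vec{v} \in \mathbb{R}^d$, $T_{\vec{v}}$ denotes translation by $\vec{v}$. Isometries act on points and on tiles; juxtaposition denotes composition, so $T_{n\vec u+\vec v}\,S_i\,T_{-\vec v}$ applies $T_{-\vec v}$ first. $\mathbb{N}$ is the set of positive integers.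
   Formalization: Connectedness of supp(p) is claimed only when all tiles of x are connected; otherwise p is a finite subset of x with (1) and (2). As written the claim fails: the tiling of the line by [0,1]∪[3,4] shifted by even integers has no nonempty finite patch. *)

theory Defs
  imports "HOL-Analysis.Analysis"
begin

text \<open>
  Euclidean space of dimension d is \<open>real ^ 'd\<close> with \<open>'d\<close> an arbitrary finite index type.
\<close>

definition direct_isometries :: "(real ^ 'd \<Rightarrow> real ^ 'd) set" where
  "direct_isometries = {\<lambda>q. A *v q + b | A b. rotation_matrix A}"

definition isometry_ball :: "real \<Rightarrow> (real ^ 'd \<Rightarrow> real ^ 'd) set" where
  "isometry_ball r =
     {\<lambda>q. A *v q + b | A b.
        rotation_matrix A \<and> onorm ((*v) (A - mat 1)) < r \<and> norm b < r}"

definition translate :: "real ^ 'd \<Rightarrow> real ^ 'd \<Rightarrow> real ^ 'd" where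
  "translate v = (\<lambda>q. q + v)"

definition tile :: "(real ^ 'd) set \<Rightarrow> bool" where
  "tile D \<longleftrightarrow> compact D \<and> D = closure (interior D)"

definition translation_equiv :: "((real ^ 'd) set \<times> (real ^ 'd) set) set" where
  "translation_equiv = {(D, E). tile D \<and> tile E \<and> (\<exists>v. E = translate v ` D)}"

definition congruence_equiv :: "((real ^ 'd) set \<times> (real ^ 'd) set) set" where
  "congruence_equiv = {(D, E). tile D \<and> tile E \<and> (\<exists>g\<in>direct_isometries. E = g ` D)}"

definition prototiles :: "(real ^ 'd) set set set" where
  "prototiles = Collect tile // translation_equiv"

definition congruence_prototiles :: "(real ^ 'd) set set set" where
  "congruence_prototiles = Collect tile // congruence_equiv"

definition tiling :: "(real ^ 'd) set set \<Rightarrow> bool" where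
  "tiling x \<longleftrightarrow>
     (\<forall>D\<in>x. tile D) \<and> \<Union>x = UNIV \<and>
     (\<forall>D\<in>x. \<forall>E\<in>x. D \<noteq> E \<longrightarrow> interior D \<inter> interior E = {})"

text \<open>
  The same formula serves both kinds of tiling space; the kind is determined by whether
  \<open>\<T>\<close> consists of translation classes or of congruence classes.
\<close>

definition tiling_space :: "(real ^ 'd) set set set \<Rightarrow> (real ^ 'd) set set set" where
  "tiling_space \<T> = {x. tiling x \<and> x \<subseteq> \<Union>\<T>}"

definition supp :: "(real ^ 'd) set set \<Rightarrow> (real ^ 'd) set" where
  "supp p = \<Union>p"

text \<open>
  Tiles need not be connected, and then a tiling may have no nonempty finite patch: on the
  line, the translates of \<open>[0,1] \<union> [3,4]\<close> by the even integers form a tiling, but if \<open>2k\<close> is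
  the largest translation vector occurring in a finite subcollection, then its union contains
  \<open>[2k,2k+1]\<close> and \<open>[2k+3,2k+4]\<close> and misses the open interval \<open>(2k+2,2k+3)\<close>. Existence
  of large finite patches can therefore only be asserted under a condition such as
  connectedness of the tiles.
\<close>

definition patch :: "(real ^ 'd) set set \<Rightarrow> (real ^ 'd) set set \<Rightarrow> bool" where
  "patch x p \<longleftrightarrow> p \<subseteq> x \<and> connected (supp p)"

end

theory Submission
  imports Defs
begin

text \<open>
  The points of space are coloured by what the tiling looks like around them, so coarsely that
  there are finitely many colours, yet so finely that equal colours force the tiles around the
  two points to agree up to small isometries. Gallai's theorem (the multidimensional van der
  Waerden theorem) then gives \<open>n\<close> and \<open>v\<close> such that \<open>v\<close> and all points \<open>v + n u\<close> with \<open>u \<in> F\<close>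
  have the same colour. The patch consists of the tiles that meet the ball of radius
  \<open>1 / \<epsilon>\<close> about \<open>v\<close>.

  Finitely many colours suffice because of compactness. A tile of a given prototile near a
  point is, relative to that point, a copy \<open>A D + b\<close> of a fixed representative \<open>D\<close>; the rotation
  \<open>A\<close> lies in a compact group and \<open>b\<close> is bounded because the copy meets a fixed ball. So
  finitely many small cells cover all positions \<open>(A, b)\<close>, and the colour of a point records
  which cells of which prototiles occur around it. Two positions \<open>(A, b)\<close> and \<open>(A', b')\<close> in the
  same cell differ by the isometry \<open>(A', b') \<circ> (A, b)\<inverse>\<close>, which is close to the identity. This
  is \<open>finite_classification_of_copies\<close>. If the cells are small enough, two copies in the same
  cell also have overlapping interiors, so a cell holds at most one tile of the tiling. Hence only
  finitely many tiles meet a ball.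

  Gallai's theorem is \<open>gallai_homothety\<close>. It is proved by induction on the finite set \<open>F\<close>; the
  heart is the colour focusing argument in \<open>colour_focusing\<close>.
\<close>

section \<open>Gallai's theorem\<close>

definition homothety :: "nat \<times> 'a \<Rightarrow> 'a \<Rightarrow> 'a::real_vector" where
  "homothety p u = snd p + real (fst p) *\<^sub>R u"

text \<open>
  Gallai's theorem for \<open>F\<close> and \<open>k\<close> colours, in its compact form: a finite set \<open>Z\<close> of homotheties
  serves all colourings at once. The finiteness is what carries the induction on \<open>F\<close>, since it
  leaves only finitely many points whose colours matter.
\<close>

definition gallai_family :: "nat \<Rightarrow> ('a::real_vector) set \<Rightarrow> (nat \<times> 'a) set \<Rightarrow> bool" where
  "gallai_family k F Z \<longleftrightarrow> finite Z \<and> (\<forall>p\<in>Z. 1 \<le> fst p) \<and>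
     (\<forall>c. range c \<subseteq> {..<k} \<longrightarrow> (\<exists>p\<in>Z. (c \<circ> homothety p) constant_on F))"

lemma gallai_familyD:
  assumes "gallai_family k F Z" and "range c \<subseteq> {..<k}"
  obtains p where "p \<in> Z" "1 \<le> fst p" "(c \<circ> homothety p) constant_on F"
  using assms unfolding gallai_family_def by metis

text \<open>
  Giving each point \<open>x\<close> the pattern of colours on the finite window \<open>x + W\<close> is again a colouring
  with finitely many colours. So there are homothetic copies of \<open>F\<close> whose points all see the
  same window.
\<close>

lemma gallai_window:
  fixes F W :: "'a::real_vector set" and k :: nat
  assumes F: "\<And>k. \<exists>Z. gallai_family k F Z" and "finite W"
  obtains Z where "finite Z" "\<And>p. p \<in> Z \<Longrightarrow> 1 \<le> fst p"
    "\<And>c. range c \<subseteq> {..<k} \<Longrightarrow>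
       \<exists>p\<in>Z. \<forall>w\<in>W. (\<lambda>u. c (homothety p u + w)) constant_on F"
proof -
  let ?P = "W \<rightarrow>\<^sub>E {..<k}"
  have "finite ?P" using assms(2) by (intro finite_PiE) auto
  then obtain e where e: "bij_betw e ?P {0..<card ?P}"
    using ex_bij_betw_finite_nat by blast
  obtain Z where Z: "gallai_family (card ?P) F Z" using F by blast
  show ?thesis
  proof (rule that)
    show "finite Z" "\<And>p. p \<in> Z \<Longrightarrow> 1 \<le> fst p" using Z by (auto simp: gallai_family_def)
    fix c :: "'a \<Rightarrow> nat" assume c: "range c \<subseteq> {..<k}"
    define r where "r = (\<lambda>x. restrict (\<lambda>w. c (x + w)) W)"
    have r: "r x \<in> ?P" for x using c by (auto simp: r_def)
    have "range (e \<circ> r) \<subseteq> {..<card ?P}"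
      using bij_betwE[OF e] r by fastforce
    then obtain p where p: "p \<in> Z" "(e \<circ> r \<circ> homothety p) constant_on F"
      using gallai_familyD[OF Z] by metis
    then obtain \<gamma> where \<gamma>: "\<And>u. u \<in> F \<Longrightarrow> e (r (homothety p u)) = \<gamma>"
      unfolding constant_on_def by auto
    have eq: "r (homothety p u) = inv_into ?P e \<gamma>" if "u \<in> F" for u
      using \<gamma>[OF that] bij_betw_inv_into_left[OF e r] by metis
    have "c (homothety p u + w) = inv_into ?P e \<gamma> w" if "u \<in> F" "w \<in> W" for u w
      using fun_cong[OF eq[OF that(1)], of w] that(2) by (simp add: r_def)
    then show "\<exists>p\<in>Z. \<forall>w\<in>W. (\<lambda>u. c (homothety p u + w)) constant_on F"
      using p(1) unfolding constant_on_def by blast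
  qed
qed

text \<open>
  For each colour in \<open>C\<close> some homothetic copy of \<open>F\<close> has that colour throughout, and the point
  that would extend it to a copy of \<open>insert a F\<close> is, for all these copies, the same focus \<open>f\<close>.
\<close>

definition focused ::
    "('a::real_vector \<Rightarrow> nat) \<Rightarrow> 'a set \<Rightarrow> 'a \<Rightarrow> (nat \<times> 'a) set \<Rightarrow> 'a \<Rightarrow> nat set \<Rightarrow> bool" where
  "focused c F a Z f C \<longleftrightarrow>
     (\<forall>\<gamma>\<in>C. \<exists>p\<in>Z. homothety p a = f \<and> (\<forall>u\<in>F. c (homothety p u) = \<gamma>))"

text \<open>
  As long as no monochromatic copy of \<open>insert a F\<close> turns up, the number \<open>r\<close> of colours focused at
  one point can be raised by one. To do so, choose a copy of \<open>F\<close> under a homothety \<open>q\<close>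
  whose points all see the same window \<open>W\<close>, large enough to contain a focused configuration with
  \<open>r\<close> colours. Replacing each of its homotheties \<open>p\<close> by the homothety \<open>u \<mapsto> q u + p u\<close> moves the
  focus from \<open>f\<close> to \<open>q a + f\<close> and keeps the colours, because \<open>q u\<close> sees the same colours for all
  \<open>u \<in> F\<close>. For the same reason the points \<open>q u + f\<close> have one colour; they form a further copy of
  \<open>F\<close>, with the same new focus. If that colour is among the \<open>r\<close> old ones, the old focus completes a monochromatic copy of
  \<open>insert a F\<close>; otherwise it is a new colour.
\<close>

lemma colour_focusing:
  fixes F :: "'a::real_vector set" and a :: 'a and k r :: nat
  assumes F: "\<And>k. \<exists>Z. gallai_family k F Z" "finite F" "F \<noteq> {}"
  shows "\<exists>Z \<Phi>. finite Z \<and> finite \<Phi> \<and> (\<forall>p\<in>Z. 1 \<le> fst p) \<and>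
     (\<forall>c. range c \<subseteq> {..<k} \<longrightarrow>
        (\<exists>p\<in>Z. (c \<circ> homothety p) constant_on insert a F) \<or>
        (\<exists>f\<in>\<Phi>. \<exists>C. C \<subseteq> {..<k} \<and> card C = r \<and> focused c F a Z f C))"
proof (induction r)
  case 0
  show ?case
    by (rule exI[of _ "{}"], rule exI[of _ "{0}"]) (auto simp: focused_def)
next
  case (Suc r)
  then obtain Z \<Phi> where Z: "finite Z" "finite \<Phi>" "\<forall>p\<in>Z. 1 \<le> fst p"
    and ZC: "\<forall>c. range c \<subseteq> {..<k} \<longrightarrow>
        (\<exists>p\<in>Z. (c \<circ> homothety p) constant_on insert a F) \<or>
        (\<exists>f\<in>\<Phi>. \<exists>C. C \<subseteq> {..<k} \<and> card C = r \<and> focused c F a Z f C)"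
    by (elim exE conjE)
  define W where "W = \<Phi> \<union> {homothety p u |p u. p \<in> Z \<and> u \<in> F}"
  have W1: "f \<in> W" if "f \<in> \<Phi>" for f using that by (simp add: W_def)
  have W2: "homothety p u \<in> W" if "p \<in> Z" "u \<in> F" for p u
    unfolding W_def using that by blast
  have "finite W" 
    using Z F(2) unfolding W_def by (intro finite_UnI finite_image_set2) simp_all
  then obtain Y
    where Y: "finite Y" "\<And>p. p \<in> Y \<Longrightarrow> 1 \<le> fst p"
    and YC: "\<And>c. range c \<subseteq> {..<k} \<Longrightarrow>
       \<exists>p\<in>Y. \<forall>w\<in>W. (\<lambda>u. c (homothety p u + w)) constant_on F"
    using gallai_window[OF F(1), of W k] by blast
  obtain u0 where u0: "u0 \<in> F" using F(3) by blast
  \<comment> \<open>The three kinds of homotheties needed below: a copy from \<open>Z\<close> seen from \<open>q u0\<close>, the sum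
    of \<open>q\<close> and a homothety from \<open>Z\<close>, and the copy of \<open>F\<close> through the translates of the old focus.\<close>
  define Z' where "Z' = {(fst p, homothety q u0 + snd p) |q p. q \<in> Y \<and> p \<in> Z}
     \<union> {(fst q + fst p, snd q + snd p) |q p. q \<in> Y \<and> p \<in> Z}
     \<union> {(fst q, snd q + f) |q f. q \<in> Y \<and> f \<in> \<Phi>}"
  define \<Phi>' where "\<Phi>' = {homothety q a + f |q f. q \<in> Y \<and> f \<in> \<Phi>}"
  have fin: "finite Z'" "finite \<Phi>'" 
    unfolding Z'_def \<Phi>'_def using Y(1) Z by (intro finite_UnI finite_image_set2; simp)+
  have pos: "\<forall>p\<in>Z'. 1 \<le> fst p" using Y(2) Z(3) by (force simp: Z'_def)
  have step: "(\<exists>p\<in>Z'. (c \<circ> homothety p) constant_on insert a F) \<or>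
        (\<exists>f\<in>\<Phi>'. \<exists>C. C \<subseteq> {..<k} \<and> card C = Suc r \<and> focused c F a Z' f C)" (is "?mono \<or> ?foc")
    if c: "range c \<subseteq> {..<k}" for c
  proof -
    obtain q where q: "q \<in> Y"
      and const: "\<And>w. w \<in> W \<Longrightarrow> (\<lambda>u. c (homothety q u + w)) constant_on F"
      using YC[OF c] by blast
    define c' where "c' = (\<lambda>x. c (homothety q u0 + x))"
    have c'W: "c (homothety q u + w) = c' w" if "u \<in> F" "w \<in> W" for u w
      using const[OF that(2)] that(1) u0 unfolding c'_def constant_on_def by metis
    have lift: ?mono if p: "p \<in> Z" "(c' \<circ> homothety p) constant_on insert a F" for p
    proof -
      have "(fst p, homothety q u0 + snd p) \<in> Z'"
        unfolding Z'_def using q p(1) by blast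
      moreover have "c \<circ> homothety (fst p, homothety q u0 + snd p) = c' \<circ> homothety p"
        by (simp add: fun_eq_iff c'_def homothety_def add.assoc)
      ultimately show ?thesis using p(2) by metis
    qed
    have "range c' \<subseteq> {..<k}" using c by (auto simp: c'_def)
    note ZC[rule_format, OF this]
    then consider (mono) p where "p \<in> Z" "(c' \<circ> homothety p) constant_on insert a F"
      | (foc) f C where "f \<in> \<Phi>" "C \<subseteq> {..<k}" "card C = r" "focused c' F a Z f C"
      by blast
    then show ?thesis
    proof cases
      case mono
      then show ?thesis using lift by blast
    next
      case foc
      show ?thesis
      proof (cases "c' f \<in> C")
        case True
        then obtain p where p: "p \<in> Z" "homothety p a = f"
          "\<forall>u\<in>F. c' (homothety p u) = c' f"
          using foc(4) unfolding focused_def by blast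
        then have "(c' \<circ> homothety p) constant_on insert a F" by (auto simp: constant_on_def)
        then show ?thesis using lift[OF p(1)] by blast
      next
        case False
        define g where "g = homothety q a + f"
        have g: "g \<in> \<Phi>'"
          unfolding \<Phi>'_def g_def using q foc(1) by blast
        have "\<exists>p\<in>Z'. homothety p a = g \<and> (\<forall>u\<in>F. c (homothety p u) = \<beta>)"
          if \<beta>: "\<beta> \<in> insert (c' f) C" for \<beta>
        proof (cases "\<beta> = c' f")
          case True
          have eq: "homothety (fst q, snd q + f) u = homothety q u + f" for u
            by (simp add: homothety_def ac_simps)
          have "(fst q, snd q + f) \<in> Z'"
            unfolding Z'_def using q foc(1) by blast
          then show ?thesis
            using c'W[OF _ W1[OF foc(1)]] True by (intro bexI) (auto simp: eq g_def)
        next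
          case False
          with \<beta> obtain p where p: "p \<in> Z" "homothety p a = f"
            "\<forall>u\<in>F. c' (homothety p u) = \<beta>"
            using foc(4) unfolding focused_def by blast
          have eq: "homothety (fst q + fst p, snd q + snd p) u = homothety q u + homothety p u" for u
            by (simp add: homothety_def scaleR_left_distrib ac_simps)
          have "(fst q + fst p, snd q + snd p) \<in> Z'"
            unfolding Z'_def using q p(1) by blast
          then show ?thesis
            using c'W W2[OF p(1)] p(2,3) by (intro bexI) (auto simp: eq g_def)
        qed
        then have "focused c F a Z' g (insert (c' f) C)" unfolding focused_def by blast
        moreover have "insert (c' f) C \<subseteq> {..<k}" using foc(2) c by (auto simp: c'_def)
        moreover have "card (insert (c' f) C) = Suc r"
          using False foc(3) finite_subset[OF foc(2)] by simp
        ultimately show ?thesis using g by blast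
      qed
    qed
  qed
  show ?case using fin pos step by blast
qed

lemma gallai_family_exists:
  fixes F :: "'a::real_vector set"
  assumes "finite F"
  shows "\<exists>Z. gallai_family k F Z"
  using assms
proof (induction F arbitrary: k)
  case empty
  show ?case by (rule exI[of _ "{(1, 0)}"]) (auto simp: gallai_family_def constant_on_def)
next
  case (insert a F)
  show ?case
  proof (cases "F = {}")
    case True
    then show ?thesis
      by (intro exI[of _ "{(1, 0)}"]) (auto simp: gallai_family_def constant_on_def)
  next
    case False
    \<comment> \<open>With only \<open>k\<close> colours, \<open>k + 1\<close> different ones cannot be focused.\<close>
    have no: "\<not> (C \<subseteq> {..<k} \<and> card C = Suc k)" for C
      using card_mono[of "{..<k}" C] by auto
    obtain Z \<Phi> where Z: "finite Z" "\<forall>p\<in>Z. 1 \<le> fst p"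
      and ZC: "\<forall>c. range c \<subseteq> {..<k} \<longrightarrow>
        (\<exists>p\<in>Z. (c \<circ> homothety p) constant_on insert a F) \<or>
        (\<exists>f\<in>\<Phi>. \<exists>C. C \<subseteq> {..<k} \<and> card C = Suc k \<and> focused c F a Z f C)"
      using colour_focusing[OF insert.IH insert.hyps(1) False, where k=k and r="Suc k" and a=a]
      by (elim exE conjE)
    have "gallai_family k (insert a F) Z"
      unfolding gallai_family_def
    proof (intro conjI Z allI impI)
      fix c :: "'a \<Rightarrow> nat" assume c: "range c \<subseteq> {..<k}"
      show "\<exists>p\<in>Z. (c \<circ> homothety p) constant_on insert a F"
        using ZC[rule_format, OF c] no by (elim disjE bexE exE conjE) blast+
    qed
    then show ?thesis by blast
  qed
qed

text \<open>
  Adding the origin to \<open>F\<close> makes the base point \<open>v\<close> itself one of the points of the common colour.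
\<close>

theorem gallai_homothety:
  fixes c :: "'a::real_vector \<Rightarrow> 'b" and F :: "'a set"
  assumes "finite F" and "finite (range c)"
  obtains n :: nat and v where "1 \<le> n" "\<And>u. u \<in> F \<Longrightarrow> c (v + real n *\<^sub>R u) = c v"
proof -
  obtain e where e: "bij_betw e (range c) {0..<card (range c)}"
    using ex_bij_betw_finite_nat[OF assms(2)] by blast
  have rc: "range (e \<circ> c) \<subseteq> {..<card (range c)}" using bij_betwE[OF e] by fastforce
  obtain Z where Z: "gallai_family (card (range c)) (insert 0 F) Z"
    using assms(1) gallai_family_exists by blast
  obtain p where p: "1 \<le> fst p" "(e \<circ> c \<circ> homothety p) constant_on insert 0 F"
    using gallai_familyD[OF Z rc] by metis
  have "c (snd p + real (fst p) *\<^sub>R u) = c (snd p)" if "u \<in> F" for u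
  proof -
    have "e (c (homothety p u)) = e (c (homothety p 0))"
      using p(2) that unfolding constant_on_def by auto
    then show ?thesis using bij_betw_imp_inj_on[OF e] by (auto simp: homothety_def dest: inj_onD)
  qed
  with p(1) show ?thesis by (rule that)
qed

section \<open>Rotations and rigid motions\<close>

text \<open>The norm of a matrix as a vector of its rows is the Frobenius norm, which bounds the
  operator norm; so closeness of matrices in the product metric is enough throughout.\<close>

lemma norm_matrix_vector_mult_le:
  fixes A :: "real ^ 'm ^ 'n"
  shows "norm (A *v x) \<le> norm A * norm x"
proof -
  have "norm (A *v x) = L2_set (\<lambda>i. \<bar>A $ i \<bullet> x\<bar>) UNIV"
    by (simp add: norm_vec_def matrix_vector_mul_component)
  also have "\<dots> \<le> L2_set (\<lambda>i. norm (A $ i) * norm x) UNIV"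
    by (intro L2_set_mono) (auto intro: Cauchy_Schwarz_ineq2)
  also have "\<dots> = norm A * norm x"
    by (simp add: L2_set_left_distrib norm_vec_def)
  finally show ?thesis .
qed

lemma norm_rotation_matrix_mult:
  fixes A :: "real ^ 'n ^ 'n"
  assumes "rotation_matrix A"
  shows "norm (A *v x) = norm x"
proof -
  have "orthogonal_transformation ((*v) A)"
    using assms by (simp add: orthogonal_transformation_matrix rotation_matrix_def)
  then show ?thesis by (simp add: orthogonal_transformation)
qed

lemma rotation_matrix_transpose:
  fixes A :: "real ^ 'n ^ 'n"
  assumes "rotation_matrix A"
  shows "rotation_matrix (transpose A)"
  using assms by (simp add: rotation_matrix_def det_transpose)

lemma rotation_matrix_mult:
  fixes A B :: "real ^ 'n ^ 'n"
  assumes "rotation_matrix A" "rotation_matrix B"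
  shows "rotation_matrix (A ** B)"
  using assms by (simp add: rotation_matrix_def det_mul orthogonal_matrix_mul)

lemma rotation_matrix_mult_transpose:
  fixes A :: "real ^ 'n ^ 'n"
  assumes "rotation_matrix A"
  shows "A ** transpose A = mat 1" "transpose A ** A = mat 1"
  using assms by (auto simp: rotation_matrix_def orthogonal_matrix_def)

lemma bounded_rotation_matrices: "bounded {A :: real ^ 'n ^ 'n. rotation_matrix A}"
proof (rule boundedI)
  fix A :: "real ^ 'n ^ 'n" assume "A \<in> {A. rotation_matrix A}"
  then have rows: "norm (A $ i) = 1" for i
    by (auto simp: rotation_matrix_def orthogonal_matrix_orthonormal_rows row_def)
  have "norm A \<le> (\<Sum>i\<in>UNIV. norm (A $ i))"
    unfolding norm_vec_def[of A] by (rule L2_set_le_sum) simp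
  then show "norm A \<le> real CARD('n)" by (simp add: rows)
qed

text \<open>
  A rigid motion is given by a rotation and a translation vector, so that positions of a
  tile are points of a Euclidean space and compactness can be used.
\<close>

definition rigid_motion :: "(real ^ 'd ^ 'd) \<times> (real ^ 'd) \<Rightarrow> real ^ 'd \<Rightarrow> real ^ 'd" where
  "rigid_motion g = (\<lambda>q. fst g *v q + snd g)"

lemma dist_rigid_motion:
  assumes "rotation_matrix (fst g)"
  shows "dist (rigid_motion g p) (rigid_motion g q) = dist p q"
  using norm_rotation_matrix_mult[OF assms, of "p - q"]
  by (simp add: rigid_motion_def dist_norm matrix_vector_mult_diff_distrib)

lemma surj_rigid_motion:
  assumes "rotation_matrix (fst g)"
  shows "\<exists>q. rigid_motion g q = y"
proof
  show "rigid_motion g (transpose (fst g) *v (y - snd g)) = y"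
    using rotation_matrix_mult_transpose(1)[OF assms]
    by (simp add: rigid_motion_def matrix_vector_mul_assoc del: transpose_matrix_vector)
qed

lemma ball_subset_rigid_motion_image:
  assumes "rotation_matrix (fst g)" and "ball a r \<subseteq> D"
  shows "ball (rigid_motion g a) r \<subseteq> rigid_motion g ` D"
proof
  fix y assume y: "y \<in> ball (rigid_motion g a) r"
  obtain q where q: "rigid_motion g q = y" using surj_rigid_motion[OF assms(1)] by blast
  have "q \<in> ball a r" using y dist_rigid_motion[OF assms(1), of a q] by (simp add: q)
  then show "y \<in> rigid_motion g ` D" using assms(2) q by blast
qed

lemma dist_rigid_motion_le:
  "dist (rigid_motion g q) (rigid_motion h q) \<le> dist g h * (1 + norm q)"
proof -
  have 1: "norm (fst g - fst h) \<le> dist g h" "norm (snd g - snd h) \<le> dist g h"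
    using dist_fst_le[of g h] dist_snd_le[of g h] by (simp_all add: dist_norm)
  have "dist (rigid_motion g q) (rigid_motion h q) = norm ((fst g - fst h) *v q + (snd g - snd h))"
    by (simp add: rigid_motion_def dist_norm matrix_vector_mult_diff_rdistrib algebra_simps)
  also have "\<dots> \<le> norm (fst g - fst h) * norm q + norm (snd g - snd h)"
    by (intro order_trans[OF norm_triangle_ineq] add_right_mono norm_matrix_vector_mult_le)
  also have "\<dots> \<le> dist g h * norm q + dist g h"
    using 1 by (intro add_mono mult_right_mono) auto
  finally show ?thesis by (simp add: algebra_simps)
qed

text \<open>
  The isometry \<open>h \<circ> g\<inverse>\<close> has rotational part \<open>C = B A\<^sup>T\<close>, where \<open>A\<close> and \<open>B\<close> are the rotations of
  \<open>g\<close> and \<open>h\<close>. Here \<open>C - 1 = (B - A) A\<^sup>T\<close> is small because \<open>A\<^sup>T\<close> preserves norms. The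
  translational part contains \<open>C - 1\<close> applied to the translation vector of \<open>g\<close>, which is why
  the size of that vector enters the bound.
\<close>

lemma rigid_motion_transition:
  assumes g: "rotation_matrix (fst g)" and h: "rotation_matrix (fst h)"
    and close: "dist g h * (1 + norm (snd g)) < \<epsilon>"
  shows "\<exists>S\<in>isometry_ball \<epsilon>. \<forall>D. S ` rigid_motion g ` D = rigid_motion h ` D"
proof -
  let ?A = "fst g" and ?B = "fst h"
  define C where "C = ?B ** transpose ?A"
  define e where "e = snd h - C *v snd g"
  have d: "dist g h \<ge> 0" by simp
  have norms: "norm (?B - ?A) \<le> dist g h" "norm (snd h - snd g) \<le> dist g h"
    using dist_fst_le[of h g] dist_snd_le[of h g] by (simp_all add: dist_norm norm_minus_commute)
  have tA: "norm (transpose ?A *v q) = norm q" for q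
    by (rule norm_rotation_matrix_mult[OF rotation_matrix_transpose[OF g]])
  have C1: "C - mat 1 = (?B - ?A) ** transpose ?A"
    unfolding C_def rotation_matrix_mult_transpose(1)[OF g, symmetric]
    by (simp add: vec_eq_iff matrix_matrix_mult_def left_diff_distrib sum_subtractf)
  have Cq: "norm ((C - mat 1) *v q) \<le> dist g h * norm q" for q
  proof -
    have "norm ((C - mat 1) *v q) = norm ((?B - ?A) *v (transpose ?A *v q))"
      by (simp only: C1 matrix_vector_mul_assoc)
    also have "\<dots> \<le> norm (?B - ?A) * norm q"
      using norm_matrix_vector_mult_le[of "?B - ?A" "transpose ?A *v q"] by (simp only: tA)
    also have "\<dots> \<le> dist g h * norm q" by (intro mult_right_mono norms) auto
    finally show ?thesis .
  qed
  have "onorm ((*v) (C - mat 1)) \<le> dist g h" by (rule onorm_le) (rule Cq)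
  also have "\<dots> < \<epsilon>" using close mult_left_mono[OF _ d, of 1 "1 + norm (snd g)"] by simp
  finally have on: "onorm ((*v) (C - mat 1)) < \<epsilon>" .
  have "e = (snd h - snd g) - (C - mat 1) *v snd g"
    by (simp add: e_def matrix_vector_mult_diff_rdistrib)
  then have "norm e \<le> norm (snd h - snd g) + norm ((C - mat 1) *v snd g)"
    by (metis norm_triangle_ineq4)
  also have "\<dots> \<le> dist g h + dist g h * norm (snd g)" by (intro add_mono norms Cq)
  also have "\<dots> < \<epsilon>" using close by (simp add: algebra_simps)
  finally have ne: "norm e < \<epsilon>" .
  have rot: "rotation_matrix C"
    unfolding C_def by (intro rotation_matrix_mult h rotation_matrix_transpose g)
  have CA: "C ** ?A = ?B"
    using rotation_matrix_mult_transpose(2)[OF g] by (simp add: C_def matrix_mul_assoc[symmetric])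
  have "C *v rigid_motion g q + e = rigid_motion h q" for q
    by (simp add: rigid_motion_def e_def matrix_vector_right_distrib matrix_vector_mul_assoc CA)
  then have "(\<lambda>q. C *v q + e) ` rigid_motion g ` D = rigid_motion h ` D" for D
    by (simp add: image_image)
  moreover have "(\<lambda>q. C *v q + e) \<in> isometry_ball \<epsilon>"
    unfolding isometry_ball_def using rot on ne by blast
  ultimately show ?thesis by blast
qed

section \<open>Finitely many kinds of copies of a tile near a point\<close>

definition copies :: "(real ^ 'd) set \<Rightarrow> (real ^ 'd) set set" where
  "copies D = {rigid_motion g ` D |g. rotation_matrix (fst g)}"

lemma translate_image_copies:
  assumes "t \<in> copies D"
  shows "translate v ` t \<in> copies D"
proof -
  obtain g where g: "rotation_matrix (fst g)" "t = rigid_motion g ` D"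
    using assms by (auto simp: copies_def)
  have "translate v ` t = rigid_motion (fst g, snd g + v) ` D"
    by (simp add: g(2) image_image translate_def rigid_motion_def add.assoc)
  then show ?thesis using g(1) unfolding copies_def by force
qed

lemma bounded_placements:
  fixes D :: "(real ^ 'd) set"
  assumes "bounded D"
  shows "bounded {g. rotation_matrix (fst g) \<and> rigid_motion g ` D \<inter> cball 0 R \<noteq> {}}"
proof -
  obtain m where m: "\<And>q. q \<in> D \<Longrightarrow> norm q \<le> m" using assms bounded_iff by metis
  have "{g. rotation_matrix (fst g) \<and> rigid_motion g ` D \<inter> cball 0 R \<noteq> {}}
      \<subseteq> {A. rotation_matrix A} \<times> cball 0 (R + m)"
  proof
    fix g assume "g \<in> {g. rotation_matrix (fst g) \<and> rigid_motion g ` D \<inter> cball 0 R \<noteq> {}}"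
    then obtain q where q: "rotation_matrix (fst g)" "q \<in> D" "norm (rigid_motion g q) \<le> R"
      by auto
    have "snd g = rigid_motion g q - fst g *v q" by (simp add: rigid_motion_def)
    then have "norm (snd g) \<le> norm (rigid_motion g q) + norm (fst g *v q)"
      by (metis norm_triangle_ineq4)
    also have "\<dots> \<le> R + m" using q m norm_rotation_matrix_mult[OF q(1)] by (simp add: add_mono)
    finally show "g \<in> {A. rotation_matrix A} \<times> cball 0 (R + m)"
      using q(1) by (cases g) simp
  qed
  then show ?thesis
    using bounded_Times[OF bounded_rotation_matrices bounded_cball] bounded_subset by blast
qed

lemma bounded_finite_centres:
  fixes P :: "'a::euclidean_space set"
  assumes "bounded P" and "0 < \<delta>"
  obtains K where "finite K" "\<And>g. g \<in> P \<Longrightarrow> \<exists>k\<in>K. dist k g < \<delta>"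
proof -
  have "compact (closure P)" using assms(1) by simp
  then obtain K where "finite K" "closure P \<subseteq> (\<Union>k\<in>K. ball k \<delta>)"
    using assms(2) unfolding compact_eq_totally_bounded by blast
  then show ?thesis using closure_subset[of P] by (intro that) (auto simp: subset_eq)
qed

text \<open>
  The positions of the copies of \<open>D\<close> that meet a ball form a bounded set, so they are within
  \<open>\<delta> / 2\<close> of finitely many centres, and \<open>\<kappa>\<close> assigns to a copy the centre near its position.
  Copies with the same centre have positions within \<open>\<delta>\<close> of each other. For small \<open>\<delta>\<close> this
  makes the transition isometry small, and it makes the interiors overlap: the images of an
  interior point \<open>a\<close> of \<open>D\<close> are so close that one of them lies in the image of a ball about \<open>a\<close>
  under the other motion.
\<close>

lemma finite_classification_of_copies:
  fixes D :: "(real ^ 'd) set" and \<epsilon> R :: real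
  assumes "tile D" and "0 < \<epsilon>"
  defines "L \<equiv> {t \<in> copies D. t \<inter> cball 0 R \<noteq> {}}"
  shows "\<exists>\<kappa> :: (real ^ 'd) set \<Rightarrow> (real ^ 'd ^ 'd) \<times> (real ^ 'd). finite (\<kappa> ` L) \<and>
    (\<forall>s\<in>L. \<forall>t\<in>L. \<kappa> s = \<kappa> t \<longrightarrow>
       (\<exists>S\<in>isometry_ball \<epsilon>. S ` s = t) \<and> interior s \<inter> interior t \<noteq> {})"
proof (cases "D = {}")
  case True
  then have "L = {}" by (auto simp: L_def copies_def)
  then show ?thesis by simp
next
  case False
  define P where "P = {g. rotation_matrix (fst g) \<and> rigid_motion g ` D \<inter> cball 0 R \<noteq> {}}"
  have "interior D \<noteq> {}" using False assms(1) unfolding tile_def by force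
  then obtain a r where r: "0 < r" "ball a r \<subseteq> D"
    by (auto simp: mem_interior)
  have bP: "bounded P"
    unfolding P_def using assms(1) by (intro bounded_placements) (simp add: tile_def compact_imp_bounded)
  then obtain M where M: "\<And>g. g \<in> P \<Longrightarrow> norm g \<le> M" using bounded_iff by metis
  \<comment> \<open>\<open>N\<close> dominates both factors by which a distance of positions is multiplied below:
    \<open>1 + norm (snd g)\<close> in the transition isometry and \<open>1 + norm a\<close> in the displacement of \<open>a\<close>.\<close>
  define N where "N = 1 + \<bar>M\<bar> + norm a"
  define \<delta> where "\<delta> = min \<epsilon> r / N"
  have N: "0 < N" by (simp add: N_def add_pos_nonneg)
  then have "0 < \<delta> / 2" using r(1) assms(2) by (simp add: \<delta>_def)
  with bP obtain K where K: "finite K" "\<And>g. g \<in> P \<Longrightarrow> \<exists>k\<in>K. dist k g < \<delta> / 2"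
    using bounded_finite_centres by blast
  have "\<forall>t\<in>L. \<exists>g\<in>P. t = rigid_motion g ` D"
    by (auto simp: L_def copies_def P_def)
  then obtain G where G: "\<And>t. t \<in> L \<Longrightarrow> G t \<in> P" "\<And>t. t \<in> L \<Longrightarrow> t = rigid_motion (G t) ` D"
    by metis
  obtain k where k: "\<And>g. g \<in> P \<Longrightarrow> k g \<in> K" "\<And>g. g \<in> P \<Longrightarrow> dist (k g) g < \<delta> / 2"
    using K(2) by metis
  have fin: "finite ((k \<circ> G) ` L)"
    by (rule finite_subset[OF _ K(1)]) 
      (intro image_subsetI, simp only: comp_apply, rule k(1)[OF G(1)])
  have "(\<exists>S\<in>isometry_ball \<epsilon>. S ` s = t) \<and> interior s \<inter> interior t \<noteq> {}"
    if st: "s \<in> L" "t \<in> L" and eq: "(k \<circ> G) s = (k \<circ> G) t" for s t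
  proof
    let ?g = "G s" and ?h = "G t"
    have rot: "rotation_matrix (fst ?g)" "rotation_matrix (fst ?h)"
      using G(1) st by (auto simp: P_def)
    have "dist ?g ?h < \<delta>"
      using k(2)[OF G(1)[OF st(1)]] k(2)[OF G(1)[OF st(2)]] eq dist_triangle3[of ?g ?h "k ?g"] by simp
    then have d: "dist ?g ?h * N < min \<epsilon> r" using N by (simp add: \<delta>_def pos_less_divide_eq)
    have "norm (snd ?g) \<le> M"
      using M[OF G(1)[OF st(1)]] norm_snd_le[of "snd ?g" "fst ?g"] by simp
    then have "1 + norm (snd ?g) \<le> N"
      using norm_ge_zero[of a] abs_ge_self[of M] unfolding N_def by linarith
    then have "dist ?g ?h * (1 + norm (snd ?g)) \<le> dist ?g ?h * N"
      by (intro mult_left_mono) auto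
    then have "dist ?g ?h * (1 + norm (snd ?g)) < \<epsilon>" using d by simp
    from rigid_motion_transition[OF rot this]
    obtain S where S: "S \<in> isometry_ball \<epsilon>"
      "\<forall>D. S ` rigid_motion ?g ` D = rigid_motion ?h ` D" by (rule bexE)
    have "S ` s = t"
      using S(2)[rule_format, of D] unfolding G(2)[OF st(1), symmetric] G(2)[OF st(2), symmetric] .
    then show "\<exists>S\<in>isometry_ball \<epsilon>. S ` s = t" using S(1) by (rule bexI)
    have "dist (rigid_motion ?h a) (rigid_motion ?g a) \<le> dist ?g ?h * (1 + norm a)"
      using dist_rigid_motion_le[of ?h a ?g] by (simp add: dist_commute)
    also have "\<dots> \<le> dist ?g ?h * N" by (intro mult_left_mono) (auto simp: N_def)
    also have "\<dots> < r" using d by simp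
    finally have "rigid_motion ?g a \<in> ball (rigid_motion ?h a) r" by simp
    moreover have "rigid_motion ?g a \<in> ball (rigid_motion ?g a) r" using r(1) by simp
    moreover have "ball (rigid_motion ?g a) r \<subseteq> interior s"
      using interior_maximal[OF ball_subset_rigid_motion_image[OF rot(1) r(2)] open_ball]
      unfolding G(2)[OF st(1), symmetric] .
    moreover have "ball (rigid_motion ?h a) r \<subseteq> interior t"
      using interior_maximal[OF ball_subset_rigid_motion_image[OF rot(2) r(2)] open_ball]
      unfolding G(2)[OF st(2), symmetric] .
    ultimately show "interior s \<inter> interior t \<noteq> {}" by blast
  qed
  with fin show ?thesis by blast
qed

text \<open>
  Here the two kinds of prototiles become alike: a translation class is contained in the class
  of all rotated and translated copies of its representative.
\<close>

lemma prototile_subset_copies: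
  fixes P :: "(real ^ 'd) set set"
  assumes "P \<in> prototiles \<or> P \<in> congruence_prototiles"
  shows "\<exists>D. tile D \<and> P \<subseteq> copies D"
proof -
  obtain D where D: "tile D" "P = translation_equiv `` {D} \<or> P = congruence_equiv `` {D}"
    using assms unfolding prototiles_def congruence_prototiles_def quotient_def by blast
  have "t \<in> copies D" if t: "t \<in> P" for t
  proof -
    have "\<exists>A b. rotation_matrix A \<and> t = (\<lambda>q. A *v q + b) ` D"
      using D(2)
    proof
      assume "P = translation_equiv `` {D}"
      then obtain v where "t = translate v ` D" using t by (auto simp: translation_equiv_def)
      moreover have "rotation_matrix (mat 1 :: real ^ 'd ^ 'd)"
        by (simp add: rotation_matrix_def orthogonal_matrix_id)
      ultimately show ?thesis
        by (intro exI[of _ "mat 1"] exI[of _ v]) (simp add: translate_def)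
    next
      assume "P = congruence_equiv `` {D}"
      then show ?thesis using t by (auto simp: congruence_equiv_def direct_isometries_def)
    qed
    then show ?thesis unfolding copies_def rigid_motion_def by force
  qed
  with D(1) show ?thesis by blast
qed

section \<open>Recurrence of patches\<close>

lemma translate_image_Int_cball:
  "t \<inter> cball v R \<noteq> {} \<longleftrightarrow> translate (- v) ` t \<inter> cball 0 R \<noteq> {}"
proof -
  have "translate (- v) q \<in> cball 0 R \<longleftrightarrow> q \<in> cball v R" for q
    by (simp add: translate_def dist_norm norm_minus_commute)
  then show ?thesis by blast
qed

lemma interior_translate: "interior (translate v ` t) = translate v ` interior t"
  using interior_translation[of v t] by (simp add: translate_def add.commute image_def)

theorem theorem4:
  fixes \<T> :: "(real ^ 'd) set set set"
    and x :: "(real ^ 'd) set set"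
    and F :: "(real ^ 'd) set"
    and \<epsilon> :: real
  assumes "finite \<T>"
    and "\<T> \<subseteq> prototiles \<or> \<T> \<subseteq> congruence_prototiles"
    and "x \<in> tiling_space \<T>"
    and "\<epsilon> > 0"
    and "finite F"
  shows "\<exists>(n::nat) v p.
           n \<ge> 1 \<and> finite p \<and> p \<subseteq> x \<and>
           ((\<forall>t\<in>x. connected t) \<longrightarrow> patch x p) \<and>
           cball v (1 / \<epsilon>) \<subseteq> supp p \<and>
           (\<forall>u\<in>F. \<forall>t\<in>p. \<exists>S\<in>isometry_ball \<epsilon>.
              (translate (real n *\<^sub>R u + v) \<circ> S \<circ> translate (- v)) ` t \<in> x)"
proof -
  define R where "R = 1 / \<epsilon>"
  have R: "0 \<le> R" using assms(4) by (simp add: R_def)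
  have x: "tiling x" "x \<subseteq> \<Union>\<T>" using assms(3) by (auto simp: tiling_space_def)
  obtain D where D: "\<And>P. P \<in> \<T> \<Longrightarrow> tile (D P)" "\<And>P. P \<in> \<T> \<Longrightarrow> P \<subseteq> copies (D P)"
    using prototile_subset_copies assms(2) by (metis subsetD)
  define L where "L P = {t \<in> copies (D P). t \<inter> cball 0 R \<noteq> {}}" for P
  have "\<forall>P\<in>\<T>. \<exists>\<kappa> :: (real ^ 'd) set \<Rightarrow> (real ^ 'd ^ 'd) \<times> (real ^ 'd). finite (\<kappa> ` L P) \<and>
    (\<forall>s\<in>L P. \<forall>t\<in>L P. \<kappa> s = \<kappa> t \<longrightarrow>
       (\<exists>S\<in>isometry_ball \<epsilon>. S ` s = t) \<and> interior s \<inter> interior t \<noteq> {})"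
    unfolding L_def using finite_classification_of_copies[OF D(1) assms(4)] by blast
  from bchoice[OF this] obtain \<kappa> :: "(real ^ 'd) set set \<Rightarrow> (real ^ 'd) set \<Rightarrow> (real ^ 'd ^ 'd) \<times> (real ^ 'd)"
    where \<kappa>: "\<forall>P\<in>\<T>. finite (\<kappa> P ` L P) \<and>
      (\<forall>s\<in>L P. \<forall>t\<in>L P. \<kappa> P s = \<kappa> P t \<longrightarrow>
         (\<exists>S\<in>isometry_ball \<epsilon>. S ` s = t) \<and> interior s \<inter> interior t \<noteq> {})" ..
  have fin\<kappa>: "finite (\<kappa> P ` L P)" if "P \<in> \<T>" for P
    using \<kappa> that by blast
  have match: "\<exists>S\<in>isometry_ball \<epsilon>. S ` s = t" and meet: "interior s \<inter> interior t \<noteq> {}"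
    if "P \<in> \<T>" "s \<in> L P" "t \<in> L P" "\<kappa> P s = \<kappa> P t" for P s t
    using \<kappa> that by simp_all
  define near where "near w = {t \<in> x. t \<inter> cball w R \<noteq> {}}" for w
  define c where "c w = {(P, \<kappa> P (translate (- w) ` t)) |P t. P \<in> \<T> \<and> t \<in> P \<and> t \<in> near w}" for w
  have inL: "translate (- w) ` t \<in> L P" if "P \<in> \<T>" "t \<in> P" "t \<in> near w" for P t w
    using that D(2)[OF that(1)] translate_image_copies[of t "D P"] translate_image_Int_cball[of t w R]
    by (auto simp: L_def near_def)
  have "range c \<subseteq> Pow (Sigma \<T> (\<lambda>P. \<kappa> P ` L P))"
    using inL by (auto simp: c_def)
  moreover have "finite (Pow (Sigma \<T> (\<lambda>P. \<kappa> P ` L P)))"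
    using assms(1) fin\<kappa> by simp
  ultimately have "finite (range c)" by (rule finite_subset)
  then obtain n v where n: "1 \<le> n" and same: "\<And>u. u \<in> F \<Longrightarrow> c (v + real n *\<^sub>R u) = c v"
    using gallai_homothety[OF assms(5)] by blast
  \<comment> \<open>Tiles near \<open>v\<close> with the same \<open>\<kappa>\<close> overlap, so they coincide; hence \<open>\<kappa>\<close> counts them.\<close>
  have "finite (near v \<inter> P)" if P: "P \<in> \<T>" for P
  proof (rule finite_imageD)
    show "finite ((\<lambda>t. \<kappa> P (translate (- v) ` t)) ` (near v \<inter> P))"
      by (rule finite_subset[OF _ fin\<kappa>[OF P]]) (use inL[OF P] in blast)
    show "inj_on (\<lambda>t. \<kappa> P (translate (- v) ` t)) (near v \<inter> P)"
    proof (rule inj_onI)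
      fix s t assume st: "s \<in> near v \<inter> P" "t \<in> near v \<inter> P"
        and eq: "\<kappa> P (translate (- v) ` s) = \<kappa> P (translate (- v) ` t)"
      have "interior (translate (- v) ` s) \<inter> interior (translate (- v) ` t) \<noteq> {}"
        using st by (intro meet[OF P _ _ eq] inL[OF P]) auto
      then have "interior s \<inter> interior t \<noteq> {}"
        by (auto simp: interior_translate) (auto simp: translate_def)
      then show "s = t" using x(1) st unfolding tiling_def near_def by blast
    qed
  qed
  moreover have "near v = (\<Union>P\<in>\<T>. near v \<inter> P)" using x(2) by (auto simp: near_def)
  ultimately have fin: "finite (near v)" using assms(1) by (metis (no_types, lifting) finite_UN_I)
  have cover: "cball v R \<subseteq> supp (near v)"
    using x(1) unfolding tiling_def supp_def near_def by blast
  have conn: "patch x (near v)" if "\<forall>t\<in>x. connected t"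
  proof -
    \<comment> \<open>Each tile near \<open>v\<close> meets the ball, so its union with the ball is connected, and all these
      unions share the centre \<open>v\<close>.\<close>
    have eq: "supp (near v) = \<Union> ((\<lambda>t. t \<union> cball v R) ` insert (cball v R) (near v))"
      using cover by (auto simp: supp_def)
    have "connected (t \<union> cball v R)" if "t \<in> insert (cball v R) (near v)" for t
      using that \<open>\<forall>t\<in>x. connected t\<close> by (auto simp: near_def intro: connected_Un)
    moreover have "v \<in> \<Inter> ((\<lambda>t. t \<union> cball v R) ` insert (cball v R) (near v))" using R by auto
    ultimately have "connected (supp (near v))"
      unfolding eq by (intro connected_Union) blast+
    then show ?thesis by (auto simp: patch_def near_def)
  qed
  have move: "\<exists>S\<in>isometry_ball \<epsilon>. (translate (real n *\<^sub>R u + v) \<circ> S \<circ> translate (- v)) ` t \<in> x"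
    if u: "u \<in> F" and t: "t \<in> near v" for u t
  proof -
    define w where "w = v + real n *\<^sub>R u"
    obtain P where P: "P \<in> \<T>" "t \<in> P" using t x(2) by (auto simp: near_def)
    then have "(P, \<kappa> P (translate (- v) ` t)) \<in> c w"
      using t same[OF u] by (auto simp: c_def w_def)
    then obtain s where s: "s \<in> P" "s \<in> near w"
      and eq: "\<kappa> P (translate (- v) ` t) = \<kappa> P (translate (- w) ` s)"
      by (auto simp: c_def)
    obtain S where S: "S \<in> isometry_ball \<epsilon>" "S ` translate (- v) ` t = translate (- w) ` s"
      using match[OF P(1) inL[OF P t] inL[OF P(1) s] eq] by blast
    have "(translate (real n *\<^sub>R u + v) \<circ> S \<circ> translate (- v)) ` t = translate w ` S ` translate (- v) ` t"
      by (simp add: image_image w_def add.commute)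
    also have "\<dots> = translate w ` translate (- w) ` s" by (simp only: S(2))
    also have "\<dots> = s" by (simp add: image_image translate_def)
    finally show ?thesis using S(1) s(2) by (auto simp: near_def)
  qed
  show ?thesis
    using n fin cover conn move by (intro exI[of _ n] exI[of _ v] exI[of _ "near v"]) (auto simp: near_def R_def)
qed

end
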